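(* Let $H = \overline{P_5}$ be the house. Then $rb(K_n, H) \leq rb(K_n, K_{2,4})$ for all $n \geq 6$.
   Context: The house $H$ is the complement of the path $P_5$ on five vertices (a $5$-cycle with one chord). $K_{2,4}$ is the complete bipartite graph with parts of sizes $2$ and $4$. For a graph $F$ and an integer $n$, the rainbow number $rb(K_n,F)$ is the minimum number $m$ such that every edge-colouring of $K_n$ using at least $m$ colours contains a rainbow copy of $F$ (a subgraph isomorphic to $F$ whose edges all have distinct colours). *)

theory Defs
  imports Main
begin

type_synonym 'a graph = "'a set \<times> 'a set set"

abbreviation verts :: "'a graph \<Rightarrow> 'a set" where "verts G \<equiv> fst G"
abbreviation edges :: "'a graph \<Rightarrow> 'a set set" where "edges G \<equiv> snd G"

definition all_edges :: "'a set \<Rightarrow> 'a set set" where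
  "all_edges V = {e. e \<subseteq> V \<and> card e = 2}"

definition simple_graph :: "'a graph \<Rightarrow> bool" where
  "simple_graph G \<longleftrightarrow> finite (verts G) \<and> edges G \<subseteq> all_edges (verts G)"

definition complement :: "'a graph \<Rightarrow> 'a graph" where
  "complement G = (verts G, all_edges (verts G) - edges G)"

(* Not necessarily induced. *)
definition subgraph :: "'a graph \<Rightarrow> 'a graph \<Rightarrow> bool" where
  "subgraph S G \<longleftrightarrow> simple_graph S \<and> verts S \<subseteq> verts G \<and> edges S \<subseteq> edges G"

definition isomorphic :: "'a graph \<Rightarrow> 'b graph \<Rightarrow> bool" where
  "isomorphic G H \<longleftrightarrow> (\<exists>f. bij_betw f (verts G) (verts H) \<and>
     (\<forall>u\<in>verts G. \<forall>v\<in>verts G. {u, v} \<in> edges G \<longleftrightarrow> {f u, f v} \<in> edges H))"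

definition complete_graph :: "nat \<Rightarrow> nat graph" where
  "complete_graph n = ({..<n}, all_edges {..<n})"

definition complete_bipartite :: "nat \<Rightarrow> nat \<Rightarrow> (nat + nat) graph" where
  "complete_bipartite r s =
     ({..<r} <+> {..<s}, {{Inl i, Inr j} | i j. i < r \<and> j < s})"

(* The index n is the number of vertices, not the number of edges. *)
definition path_graph :: "nat \<Rightarrow> nat graph" where
  "path_graph n = ({..<n}, {{i, Suc i} | i. Suc i < n})"

definition house :: "nat graph" where
  "house = complement (path_graph 5)"

(* Only the values of c on the edges of G are relevant. *)
definition has_rainbow_copy :: "'a graph \<Rightarrow> ('a set \<Rightarrow> 'c) \<Rightarrow> 'b graph \<Rightarrow> bool" where
  "has_rainbow_copy G c F \<longleftrightarrow>
     (\<exists>S. subgraph S G \<and> isomorphic S F \<and> inj_on c (edges S))"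

(* A colouring of a finite graph uses finitely many colours, so natural numbers suffice
   as colours.  The defining condition holds vacuously once m exceeds the number of
   edges of K_n, so the minimum always exists. *)
definition rb :: "nat \<Rightarrow> 'a graph \<Rightarrow> nat" where
  "rb n F = (LEAST m. \<forall>c :: nat set \<Rightarrow> nat.
     m \<le> card (c ` edges (complete_graph n)) \<longrightarrow> has_rainbow_copy (complete_graph n) c F)"

lemma simple_graph_path_graph: "simple_graph (path_graph n)"
  by (auto simp: simple_graph_def path_graph_def all_edges_def)

lemma simple_graph_complete_graph: "simple_graph (complete_graph n)"
  by (auto simp: simple_graph_def complete_graph_def)

lemma simple_graph_complete_bipartite: "simple_graph (complete_bipartite r s)"
  by (auto simp: simple_graph_def complete_bipartite_def all_edges_def)

(* The 5-cycle 0-2-4-1-3-0 with the chord 0-4. *)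
lemma edges_house: "edges house = {{0,2}, {2,4}, {4,1}, {1,3}, {3,0}, {0,4}}" (is "_ = ?R")
proof (rule set_eqI)
  have path: "{u, v} \<in> edges (path_graph 5) \<longleftrightarrow> v = Suc u \<or> u = Suc v"
    if "u < 5" "v < 5" for u v
    using that by (auto simp: path_graph_def doubleton_eq_iff)
  have pair: "{u, v} \<in> edges house \<longleftrightarrow> u < 5 \<and> v < 5 \<and> u \<noteq> v \<and> v \<noteq> Suc u \<and> u \<noteq> Suc v" for u v
    using path[of u v]
    by (auto simp: house_def complement_def all_edges_def path_graph_def card_2_iff doubleton_eq_iff)
  fix e
  show "e \<in> edges house \<longleftrightarrow> e \<in> ?R"
  proof
    assume e: "e \<in> edges house"
    then have "card e = 2" by (simp add: house_def complement_def all_edges_def)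
    then obtain u v where uv: "e = {u, v}" by (meson card_2_iff)
    have lt: "x = 0 \<or> x = 1 \<or> x = 2 \<or> x = 3 \<or> x = 4" if "x < 5" for x :: nat
      using that by linarith
    from e uv have p: "u < 5" "v < 5" "u \<noteq> v" "v \<noteq> Suc u" "u \<noteq> Suc v"
      by (simp_all add: pair)
    show "e \<in> ?R"
      using lt[OF p(1)] lt[OF p(2)] p(3-5) unfolding uv
      by (elim disjE) (simp_all add: doubleton_eq_iff)
  next
    assume "e \<in> ?R"
    then show "e \<in> edges house"
      by (elim insertE emptyE) (simp_all only: pair, simp_all)
  qed
qed

lemma rb_works:
  fixes c :: "nat set \<Rightarrow> nat"
  assumes "rb n F \<le> card (c ` edges (complete_graph n))"
  shows "has_rainbow_copy (complete_graph n) c F"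
proof -
  let ?E = "edges (complete_graph n)"
  let ?P = "\<lambda>m. \<forall>c :: nat set \<Rightarrow> nat. m \<le> card (c ` ?E) \<longrightarrow> has_rainbow_copy (complete_graph n) c F"
  have fin: "finite ?E" by (simp add: complete_graph_def all_edges_def)
  have "\<not> Suc (card ?E) \<le> card (d ` ?E)" for d :: "nat set \<Rightarrow> nat"
    using card_image_le[OF fin, of d] by simp
  then have "?P (Suc (card ?E))" by blast
  then have "?P (rb n F)" unfolding rb_def by (rule LeastI)
  with assms show ?thesis by blast
qed

end

theory Submission
  imports Defs
begin

text \<open>
  Every edge-colouring of \<open>K\<^sub>n\<close> with a rainbow \<open>K\<^sub>2\<^sub>,\<^sub>4\<close> has a rainbow house, which gives the inequality.
  Adding the edge \<open>xy\<close> to a \<open>K\<^sub>2\<^sub>,\<^sub>3\<close> with parts \<open>{a, b}\<close> and \<open>{x, y, z}\<close> and then deleting any one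
  of \<open>ax\<close>, \<open>ay\<close>, \<open>bx\<close>, \<open>by\<close> leaves a house. So if the \<open>K\<^sub>2\<^sub>,\<^sub>3\<close> is rainbow and there is no rainbow
  house, the colour of \<open>xy\<close> must be that of \<open>az\<close> or \<open>bz\<close>. In a rainbow \<open>K\<^sub>2\<^sub>,\<^sub>4\<close> there are two
  choices of \<open>z\<close>, and they lead to disjoint sets of possible colours.
\<close>

text \<open>Copies need not be induced, so an injective vertex map that sends edges to edges carries
  all the information: the copy is the image of \<open>F\<close>. This lets explicit vertices stand
  in for abstract isomorphisms.\<close>

lemma has_rainbow_copy_iff_embedding:
  assumes F: "simple_graph F"
  shows "has_rainbow_copy G c F \<longleftrightarrow>
    (\<exists>g. inj_on g (verts F) \<and> g ` verts F \<subseteq> verts G \<and> (`) g ` edges F \<subseteq> edges G \<and>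
         inj_on (\<lambda>e. c (g ` e)) (edges F))" (is "_ \<longleftrightarrow> (\<exists>g. ?emb g)")
proof
  assume "has_rainbow_copy G c F"
  then obtain S f where S: "verts S \<subseteq> verts G" "edges S \<subseteq> edges G" and inj: "inj_on c (edges S)"
    and f: "bij_betw f (verts S) (verts F)"
    and iso: "\<And>u v. u \<in> verts S \<Longrightarrow> v \<in> verts S \<Longrightarrow> {u, v} \<in> edges S \<longleftrightarrow> {f u, f v} \<in> edges F"
    unfolding has_rainbow_copy_def subgraph_def isomorphic_def by blast
  \<comment> \<open>The isomorphism runs from the copy to \<open>F\<close>, so the embedding is its
    inverse.\<close>
  define g where "g = inv_into (verts S) f"
  have g: "bij_betw g (verts F) (verts S)"
    unfolding g_def using f by (rule bij_betw_inv_into)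
  have fg: "f (g i) = i" if "i \<in> verts F" for i
    using f that unfolding g_def by (rule bij_betw_inv_into_right)
  have edge: "g ` e \<in> edges S" if "e \<in> edges F" for e
  proof -
    from that F have "e \<subseteq> verts F" "card e = 2"
      by (auto simp: simple_graph_def all_edges_def)
    then obtain i j where e: "e = {i, j}" "i \<in> verts F" "j \<in> verts F"
      by (auto simp: card_2_iff)
    then show ?thesis
      using iso[of "g i" "g j"] that fg bij_betwE[OF g] by simp
  qed
  have "inj_on ((`) g) (edges F)"
    using F inj_on_subset[OF inj_on_image_Pow[OF bij_betw_imp_inj_on[OF g]]]
    by (auto simp: simple_graph_def all_edges_def)
  moreover have "inj_on c ((`) g ` edges F)"
    using inj edge by (auto intro: inj_on_subset)
  ultimately have "inj_on (\<lambda>e. c (g ` e)) (edges F)"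
    using comp_inj_on[of "(`) g" "edges F" c] by (simp add: comp_def)
  then have "?emb g"
    using S g edge by (auto simp: bij_betw_def)
  then show "\<exists>g. ?emb g" by (intro exI[of _ g])
next
  assume "\<exists>g. ?emb g"
  then obtain g where inj: "inj_on g (verts F)" and V: "g ` verts F \<subseteq> verts G"
    and E: "(`) g ` edges F \<subseteq> edges G" and c: "inj_on (\<lambda>e. c (g ` e)) (edges F)"
    by blast
  define f where "f = inv_into (verts F) g"
  have fg: "f (g i) = i" if "i \<in> verts F" for i
    unfolding f_def using inj that by (rule inv_into_f_f)
  let ?S = "(g ` verts F, (`) g ` edges F)"
  have sub: "e \<subseteq> verts F" if "e \<in> edges F" for e
    using F that by (auto simp: simple_graph_def all_edges_def)
  have card: "card e = 2" if "e \<in> edges F" for e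
    using F that by (auto simp: simple_graph_def all_edges_def)
  have "g ` e \<in> all_edges (g ` verts F)" if "e \<in> edges F" for e
    using image_mono[OF sub[OF that], of g] card_image[OF inj_on_subset[OF inj sub[OF that]]]
      card[OF that]
    by (simp add: all_edges_def)
  then have "simple_graph ?S"
    using F by (simp add: simple_graph_def image_subset_iff)
  then have "subgraph ?S G"
    using V E by (simp add: subgraph_def)
  moreover have "isomorphic ?S F"
  proof -
    have "bij_betw f (g ` verts F) (verts F)"
      unfolding f_def using inj by (intro bij_betw_inv_into inj_on_imp_bij_betw)
    moreover have "{g i, g j} \<in> (`) g ` edges F \<longleftrightarrow> {i, j} \<in> edges F"
      if "i \<in> verts F" "j \<in> verts F" for i j
    proof
      assume "{g i, g j} \<in> (`) g ` edges F"
      then obtain e where e: "e \<in> edges F" "g ` {i, j} = g ` e" by auto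
      \<comment> \<open>Injectivity of \<open>g\<close> on vertices makes its image map injective on
        subsets of \<open>verts F\<close>, so an edge is determined by its image.\<close>
      have "{i, j} \<subseteq> verts F" using that by simp
      then have "{i, j} = e"
        using inj_on_image_eq_iff[OF inj _ sub] e by blast
      with e show "{i, j} \<in> edges F" by simp
    next
      assume "{i, j} \<in> edges F"
      then show "{g i, g j} \<in> (`) g ` edges F"
        by (intro image_eqI[of _ _ "{i, j}"]) simp_all
    qed
    ultimately show ?thesis
      unfolding isomorphic_def by (intro exI[of _ f]) (auto simp: fg)
  qed
  moreover have "inj_on c (edges ?S)"
    using c by (auto simp: inj_on_def)
  ultimately show "has_rainbow_copy G c F"
    unfolding has_rainbow_copy_def by blast
qed

lemma simple_graph_house: "simple_graph house"
  by (auto simp: house_def complement_def simple_graph_def path_graph_def)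

text \<open>The six listed edges form the 4-cycle \<open>a x b z\<close> and a roof \<open>y\<close>
  over its side \<open>ax\<close>.\<close>

lemma rainbow_houseI:
  assumes V: "{a, b, x, y, z} \<subseteq> {..<n}" and dist: "distinct [a, b, x, y, z]"
    and c: "distinct (map c [{a, x}, {x, b}, {b, z}, {z, a}, {a, y}, {y, x}])"
  shows "has_rainbow_copy (complete_graph n) c house"
proof -
  \<comment> \<open>This order matches \<open>edges_house\<close>: the 5-cycle 0-2-4-1-3 becomes
    \<open>a y x b z\<close>, and the chord 0-4 becomes \<open>ax\<close>.\<close>
  define g where "g = nth [a, b, y, z, x]"
  have g: "g 0 = a" "g 1 = b" "g (Suc 0) = b" "g 2 = y" "g 3 = z" "g 4 = x"
    by (simp_all add: g_def numeral_eq_Suc)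
  have V5: "verts house = {0, 1, 2, 3, 4}"
    by (auto simp: house_def complement_def path_graph_def)
  have "inj_on g (verts house)" "g ` verts house \<subseteq> {..<n}"
    using dist V by (auto simp: V5 g)
  moreover have "(`) g ` edges house \<subseteq> edges (complete_graph n)"
    using dist V by (auto simp: edges_house g complete_graph_def all_edges_def)
  moreover have "inj_on (\<lambda>e. c (g ` e)) (edges house)"
    using c by (auto simp: edges_house g insert_commute)
  ultimately show ?thesis
    unfolding has_rainbow_copy_iff_embedding[OF simple_graph_house]
    by (auto simp: complete_graph_def)
qed

lemma rainbow_K23_chord_colour:
  assumes V: "{a, b, x, y, z} \<subseteq> {..<n}" and dist: "distinct [a, b, x, y, z]"
    and c: "distinct (map c [{a, x}, {a, y}, {a, z}, {b, x}, {b, y}, {b, z}])"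
    and no_house: "\<not> has_rainbow_copy (complete_graph n) c house"
  shows "c {x, y} \<in> {c {a, z}, c {b, z}}"
proof (rule ccontr)
  assume new: "c {x, y} \<notin> {c {a, z}, c {b, z}}"
  \<comment> \<open>With \<open>{p, q} = {a, b}\<close> and \<open>{v, w} = {x, y}\<close>, this
    house is the \<open>K\<^sub>2\<^sub>,\<^sub>3\<close> plus \<open>xy\<close> with the edge
    \<open>qw\<close> deleted.\<close>
  have no: "\<not> distinct (map c [{p, v}, {v, q}, {q, z}, {z, p}, {p, w}, {w, v}])"
    if "{p, q, v, w, z} \<subseteq> {..<n}" "distinct [p, q, v, w, z]" for p q v w
    using no_house by (rule contrapos_nn) (rule rainbow_houseI[OF that])
  have comm: "{x, a} = {a, x}" "{y, a} = {a, y}" "{z, a} = {a, z}" "{x, b} = {b, x}"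
    "{y, b} = {b, y}" "{z, b} = {b, z}" "{y, x} = {x, y}"
    by (rule insert_commute)+
  \<comment> \<open>The five remaining edges of the \<open>K\<^sub>2\<^sub>,\<^sub>3\<close> have
    distinct colours, so the repetition involves \<open>xy\<close>. The deleted edges are in turn
    \<open>by\<close>, \<open>bx\<close>, \<open>ay\<close>, \<open>ax\<close>.\<close>
  have "c {x, y} \<in> {c {a, x}, c {b, x}, c {a, y}}"
    using no[of a b x y] V dist c new by (auto simp: comm)
  moreover have "c {x, y} \<in> {c {a, y}, c {b, y}, c {a, x}}"
    using no[of a b y x] V dist c new by (auto simp: comm)
  moreover have "c {x, y} \<in> {c {b, x}, c {a, x}, c {b, y}}"
    using no[of b a x y] V dist c new by (auto simp: comm)
  moreover have "c {x, y} \<in> {c {b, y}, c {a, y}, c {b, x}}"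
    using no[of b a y x] V dist c new by (auto simp: comm)
  \<comment> \<open>Each of the four candidate colours is missing from one of the four sets.\<close>
  ultimately show False
    using c by auto
qed

lemma rainbow_K24_imp_rainbow_house:
  assumes "has_rainbow_copy (complete_graph n) c (complete_bipartite 2 4)"
  shows "has_rainbow_copy (complete_graph n) c house"
proof (rule ccontr)
  assume no_house: "\<not> ?thesis"
  let ?K = "complete_bipartite 2 4"
  obtain g where inj: "inj_on g (verts ?K)" and V: "g ` verts ?K \<subseteq> {..<n}"
    and c: "inj_on (\<lambda>e. c (g ` e)) (edges ?K)"
    using assms unfolding has_rainbow_copy_iff_embedding[OF simple_graph_complete_bipartite]
    by (auto simp: complete_graph_def)
  define a b where "a = g (Inl 0)" and "b = g (Inl 1)"
  define x where "x i = g (Inr i)" for i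
  have K: "Inl 0 \<in> verts ?K" "Inl 1 \<in> verts ?K" "\<And>i. i < 4 \<Longrightarrow> Inr i \<in> verts ?K"
    by (auto simp: complete_bipartite_def)
  have Vs: "a < n" "b < n" "\<And>i. i < 4 \<Longrightarrow> x i < n"
    using V K by (auto simp: a_def b_def x_def)
  have dist: "a \<noteq> b" "\<And>i. i < 4 \<Longrightarrow> a \<noteq> x i" "\<And>i. i < 4 \<Longrightarrow> b \<noteq> x i"
    "\<And>i j. i < 4 \<Longrightarrow> j < 4 \<Longrightarrow> x i = x j \<longleftrightarrow> i = j"
    using inj_on_eq_iff[OF inj] K by (simp_all add: a_def b_def x_def)
  have col: "c (g ` {Inl i, Inr j}) = c (g ` {Inl k, Inr l}) \<longleftrightarrow> i = k \<and> j = l"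
    if "i < 2" "j < 4" "k < 2" "l < 4" for i j k l
  proof -
    have "{Inl i, Inr j} \<in> edges ?K" "{Inl k, Inr l} \<in> edges ?K"
      using that by (auto simp: complete_bipartite_def)
    then show ?thesis
      \<comment> \<open>Images under \<open>g\<close> stay folded so that the injectivity rule
        matches.\<close>
      using inj_on_eq_iff[OF c] by (simp add: doubleton_eq_iff del: image_insert)
  qed
  have cols: "c {a, x i} = c {a, x j} \<longleftrightarrow> i = j" "c {b, x i} = c {b, x j} \<longleftrightarrow> i = j"
    "c {a, x i} \<noteq> c {b, x j}" "c {b, x i} \<noteq> c {a, x j}" if "i < 4" "j < 4" for i j
    using col[of 0 i 0 j] col[of 1 i 1 j] col[of 0 i 1 j] col[of 1 i 0 j] that
    by (simp_all add: a_def b_def x_def)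
  \<comment> \<open>The pair \<open>x 0\<close>, \<open>x 1\<close> is fixed, and \<open>x k\<close>
    serves as the third vertex \<open>z\<close>.\<close>
  have "c {x 0, x 1} \<in> {c {a, x k}, c {b, x k}}" if "k = 2 \<or> k = 3" for k
    using that by (intro rainbow_K23_chord_colour[OF _ _ _ no_house])
      (auto simp: Vs dist cols)
  from this[of 2] this[of 3] show False
    using cols[of 2 3] by auto
qed

theorem theorem12:
  fixes n :: nat
  assumes "n \<ge> 6"
  shows "rb n house \<le> rb n (complete_bipartite 2 4)"
proof -
  have "has_rainbow_copy (complete_graph n) c house"
    if "rb n (complete_bipartite 2 4) \<le> card (c ` edges (complete_graph n))" for c :: "nat set \<Rightarrow> nat"
    by (intro rainbow_K24_imp_rainbow_house rb_works that)
  then show ?thesis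
    \<comment> \<open>As \<open>rb n house\<close> is a minimum, it suffices that this number of
      colours forces a rainbow house.\<close>
    unfolding rb_def[of n house] by (intro Least_le allI impI)
qed

end
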